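(* Let $\alpha\in(0,1)$ and let $\mathbf{e}_\alpha:(0,\infty)\to(0,\infty)$ be the function $\mathbf{e}_\alpha(q)=q^\alpha$. The following assertions are equivalent: (i) $\alpha\in(0,1/2]$. (ii) For every $\Psi\in\mathbf{B}_3$, $\Psi\circ\mathbf{e}_\alpha\in\mathbf{B}_2$.
   Context: $\mathbf{B}_2$ (the cone of Bernstein functions) is the set of all functions $\Phi_{a,b,\Lambda}:(0,\infty)\to[0,\infty)$ of the form $$\Phi_{a,b,\Lambda}(q)=a+bq+\int_{(0,\infty)}(1-e^{-qx})\,\Lambda(dx),$$ where $a,b\ge 0$ and $\Lambda$ is a positive measure on $(0,\infty)$ with $\int_{(0,\infty)}(x\wedge 1)\,\Lambda(dx)<\infty$. $\mathbf{B}_3$ (the cone of (sub)critical branching mechanisms) is the set of all functions $\Psi_{a,b,\Pi}:(0,\infty)\to[0,\infty)$ of the form $$\Psi_{a,b,\Pi}(q)=aq+bq^2+\int_{(0,\infty)}(e^{-qx}-1+qx)\,\Pi(dx),$$ where $a,b\ge 0$ and $\Pi$ is a positive measure on $(0,\infty)$ with $\int_{(0,\infty)}(x\wedge x^2)\,\Pi(dx)<\infty$. *)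

theory Defs
  imports "HOL-Analysis.Analysis"
begin

definition pos_reals :: "real measure" where
  "pos_reals = restrict_space borel {0<..}"

definition bernstein_measure :: "real measure \<Rightarrow> bool" where
  "bernstein_measure \<Lambda> \<longleftrightarrow>
     sets \<Lambda> = sets pos_reals \<and> (\<integral>\<^sup>+x. ennreal (min x 1) \<partial>\<Lambda>) < \<infinity>"

definition branching_measure :: "real measure \<Rightarrow> bool" where
  "branching_measure \<mu> \<longleftrightarrow>
     sets \<mu> = sets pos_reals \<and> (\<integral>\<^sup>+x. ennreal (min x (x\<^sup>2)) \<partial>\<mu>) < \<infinity>"

(* For q > 0 the integrands below are nonnegative, and they are integrable under the
   corresponding condition on the measure, so the Bochner integrals are genuine. *)

definition bernstein_fun :: "real \<Rightarrow> real \<Rightarrow> real measure \<Rightarrow> real \<Rightarrow> real" where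
  "bernstein_fun a b \<Lambda> q = a + b * q + (\<integral>x. (1 - exp (- q * x)) \<partial>\<Lambda>)"

definition branching_fun :: "real \<Rightarrow> real \<Rightarrow> real measure \<Rightarrow> real \<Rightarrow> real" where
  "branching_fun a b \<mu> q = a * q + b * q\<^sup>2 + (\<integral>x. (exp (- q * x) - 1 + q * x) \<partial>\<mu>)"

(* A function on the open half-line is represented by any total function extending it:
   membership in either cone depends only on the values at q > 0. *)

definition B2 :: "(real \<Rightarrow> real) set" where
  "B2 = {f. \<exists>a b \<Lambda>. 0 \<le> a \<and> 0 \<le> b \<and> bernstein_measure \<Lambda> \<and>
              (\<forall>q>0. f q = bernstein_fun a b \<Lambda> q)}"

definition B3 :: "(real \<Rightarrow> real) set" where
  "B3 = {f. \<exists>a b \<mu>. 0 \<le> a \<and> 0 \<le> b \<and> branching_measure \<mu> \<and>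
              (\<forall>q>0. f q = branching_fun a b \<mu> q)}"

definition e_pow :: "real \<Rightarrow> real \<Rightarrow> real" where
  "e_pow \<alpha> q = q powr \<alpha>"

end

theory Submission
  imports Defs "HOL-Complex_Analysis.Cauchy_Integral_Formula"
begin

text \<open>
  Necessity of \<open>\<alpha> \<le> 1/2\<close>. The function \<open>q\<^sup>2\<close> is a branching mechanism, so \<open>q powr (2 * \<alpha>)\<close> would be
  a Bernstein function \<open>f\<close>, and these satisfy \<open>f (2 q) \<le> 2 f q\<close> (lemma \<open>B2_doubling\<close>).

  Sufficiency. The terms \<open>a q\<close> and \<open>b q\<^sup>2\<close> become powers with exponents in \<open>(0, 1]\<close>, which are
  Bernstein functions. For the integral term it is enough to write, for each \<open>x > 0\<close>,
  \<open>exp (- x q\<^sup>\<alpha>) - 1 + x q\<^sup>\<alpha>\<close> as the integral of \<open>1 - exp (- q y)\<close> against a nonnegative density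
  in \<open>y\<close>, and to integrate over \<open>x\<close> (lemma \<open>jump_density_mixture\<close>). The density comes from the
  Stieltjes-type formula (lemma \<open>spectral_representation\<close>)

  \<open>exp (- x q\<^sup>\<alpha>) - 1 + x q\<^sup>\<alpha> = (1 / \<pi>) \<integral> q / (r (r + q)) m(x, r) dr\<close> over \<open>r > 0\<close>, where
  \<open>m(x, r) = x r\<^sup>\<alpha> sin (\<pi> \<alpha>) - exp (- x r\<^sup>\<alpha> cos (\<pi> \<alpha>)) sin (x r\<^sup>\<alpha> sin (\<pi> \<alpha>))\<close>

  together with \<open>q / (r (r + q)) = \<integral> (1 - exp (- q y)) exp (- y r) dy\<close> over \<open>y > 0\<close>. For \<open>\<alpha> \<le> 1/2\<close> one has
  \<open>cos (\<pi> \<alpha>) \<ge> 0\<close>, and the kernel \<open>m\<close> is nonnegative at sight. The formula expresses the analytic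
  function on the left through its imaginary part on the cut along the negative half-line. It is
  derived for \<open>q = 1\<close>, which suffices by scaling, from the mean value property on discs after
  mapping the unit disc onto the right half-plane and this onto the slit plane by squaring; the
  radius of the discs tends to \<open>1\<close>.
\<close>

section \<open>Mean values over circles, and two elementary inequalities\<close>

lemma mean_value_circle:
  fixes G :: "complex \<Rightarrow> complex"
  assumes "G holomorphic_on ball 0 1" "0 < \<rho>" "\<rho> < 1"
  shows "((\<lambda>t. G (of_real \<rho> * cis t)) has_integral (2 * pi * G 0)) {0..2*pi}"
proof -
  have "G holomorphic_on cball 0 \<rho>"
    using assms by (auto intro: holomorphic_on_subset)
  then have "((\<lambda>u. G u / (u - 0)) has_contour_integral 2 * of_real pi * \<i> * G 0) (circlepath 0 \<rho>)"
    using assms(2) by (intro Cauchy_integral_circlepath_simple) auto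
  then have "((\<lambda>t. G (of_real \<rho> * cis t) / (of_real \<rho> * cis t) * of_real \<rho> * \<i> * cis t)
      has_integral 2 * of_real pi * \<i> * G 0) {0..2*pi}"
    unfolding circlepath_def by (subst (asm) has_contour_integral_part_circlepath_iff) auto
  also have "(\<lambda>t. G (of_real \<rho> * cis t) / (of_real \<rho> * cis t) * of_real \<rho> * \<i> * cis t)
      = (\<lambda>t. \<i> * G (of_real \<rho> * cis t))"
    using assms(2) by (auto simp: field_simps)
  finally have "((\<lambda>t. (-\<i>) * (\<i> * G (of_real \<rho> * cis t)))
      has_integral (-\<i>) * (2 * of_real pi * \<i> * G 0)) {0..2*pi}"
    by (rule has_integral_mult_right)
  moreover have "(-\<i>) * (\<i> * z) = z" "(-\<i>) * (2 * of_real pi * \<i> * z) = of_real (2 * pi) * z" for z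
    by (simp_all add: algebra_simps)
  ultimately show ?thesis by (simp only:)
qed

text \<open>For a function commuting with conjugation the two half circles contribute complex
  conjugate amounts, so that the upper one alone determines the mean value.\<close>
lemma mean_value_half_circle:
  fixes G :: "complex \<Rightarrow> complex"
  assumes hol: "G holomorphic_on ball 0 1" and "0 < \<rho>" "\<rho> < 1"
    and sym: "\<And>z. z \<in> ball 0 1 \<Longrightarrow> G (cnj z) = cnj (G z)"
  shows "((\<lambda>t. Re (G (of_real \<rho> * cis t))) has_integral (pi * Re (G 0))) {0..pi}"
proof -
  define h where "h t = Re (G (of_real \<rho> * cis t))" for t
  have full: "(h has_integral (2 * pi * Re (G 0))) {0..2*pi}"
    using has_integral_Re[OF mean_value_circle[OF assms(1-3)]] by (simp add: h_def[abs_def])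
  then have int: "h integrable_on {0..2*pi}" by blast
  have half: "h integrable_on {0..pi}"
    by (rule integrable_on_subinterval[OF int]) auto
  then have I: "(h has_integral integral {0..pi} h) {0..pi}" by blast
  have refl: "h (2 * pi - t) = h t" for t
  proof -
    have "of_real \<rho> * cis (2*pi - t) = cnj (of_real \<rho> * cis t)"
      by (simp add: complex_eq_iff)
    then show ?thesis
      using sym[of "of_real \<rho> * cis t"] assms(2,3) by (simp add: h_def norm_mult)
  qed
  have "((\<lambda>t. h (- t + 2*pi)) has_integral (1 / 1) *\<^sub>R integral {0..pi} h) ((\<lambda>x. (1/(-1)) * x + - (1/(-1)*(2*pi))) ` {0..pi})"
    using has_integral_affinity[of h "integral {0..pi} h" 0 pi "-1" "2*pi"] I by simp
  moreover have "(\<lambda>x. (1/(-1)) * x + - (1/(-1)*(2*pi))) ` {0..pi} = {pi..2*pi::real}"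
    by (auto simp: image_iff intro!: bexI[of _ "2*pi-x" for x])
  ultimately have "(h has_integral integral {0..pi} h) {pi..2*pi}"
    using refl by (simp add: add.commute)
  then have "(h has_integral integral {0..pi} h + integral {0..pi} h) {0..2*pi}"
    by (rule has_integral_combine[rotated 2, OF I]) auto
  from has_integral_unique[OF full this] have "integral {0..pi} h = pi * Re (G 0)"
    by simp
  then show ?thesis using I by (simp add: h_def[abs_def])
qed

lemma norm_exp_minus_le:
  fixes u :: complex
  assumes "Re u \<ge> 0"
  shows "norm (exp (- u) - 1) \<le> norm u"
proof -
  have "norm (exp (- u) - exp (- 0)) \<le> 1 * norm (u - 0)"
  proof (rule field_differentiable_bound[where S="{z. 0 \<le> Re z}"])
    show "convex {z. 0 \<le> Re z}" by (rule convex_halfspace_Re_ge)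
    show "((\<lambda>z. exp (- z)) has_field_derivative - exp (-z)) (at z within {z. 0 \<le> Re z})" for z :: complex
      by (auto intro!: derivative_eq_intros)
    show "norm (- exp (- z)) \<le> 1" if "z \<in> {z. 0 \<le> Re z}" for z :: complex
      using that by simp
  qed (use assms in auto)
  then show ?thesis by simp
qed

lemma Jordan_sin_ge:
  fixes u :: real
  assumes "0 \<le> u" "u \<le> pi / 2"
  shows "2 * u / pi \<le> sin u"
proof -
  have "concave_on {0..pi} sin"
    by (rule f''_le0_imp_concave[where f'=cos and f''="\<lambda>x. - sin x"])
       (auto intro!: derivative_eq_intros sin_ge_zero)
  then have "concave_on {0..pi} sin \<and> (2*u/pi) \<ge> 0 \<and> 2*u/pi \<le> 1"
    using assms by (auto simp: field_simps)
  then have "sin ((1 - 2*u/pi) *\<^sub>R 0 + (2*u/pi) *\<^sub>R (pi/2)) \<ge> (1 - 2*u/pi) * sin 0 + (2*u/pi) * sin (pi/2)"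
    by (intro concave_onD) auto
  then show ?thesis by simp
qed

section \<open>The spectral representation of \<open>exp (- x q\<^sup>\<alpha>) - 1 + x q\<^sup>\<alpha>\<close>\<close>

text \<open>The negative of the imaginary part of \<open>exp (- x z\<^sup>\<alpha>) - 1 + x z\<^sup>\<alpha>\<close> at the lower edge
  \<open>z = r exp (- \<i> \<pi>)\<close>, \<open>r > 0\<close>, of the cut along the negative half-line.\<close>

definition spectral_kernel :: "real \<Rightarrow> real \<Rightarrow> real \<Rightarrow> real" where
  "spectral_kernel \<alpha> x r =
     x * r powr \<alpha> * sin (pi * \<alpha>)
     - exp (- (x * r powr \<alpha> * cos (pi * \<alpha>))) * sin (x * r powr \<alpha> * sin (pi * \<alpha>))"

text \<open>This gives the density its sign: since \<open>\<alpha> \<le> 1/2\<close>, \<open>cos (\<pi> \<alpha>) \<ge> 0\<close> and the exponential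
  is at most \<open>1\<close>, while \<open>sin s \<le> s\<close>.\<close>
lemma spectral_kernel_nonneg:
  assumes "0 < \<alpha>" "\<alpha> \<le> 1/2" "0 \<le> x"
  shows "0 \<le> spectral_kernel \<alpha> x r"
proof -
  define c where "c = x * r powr \<alpha> * cos (pi * \<alpha>)"
  define s where "s = x * r powr \<alpha> * sin (pi * \<alpha>)"
  have a1: "pi * \<alpha> \<le> pi / 2" and a2: "0 \<le> pi * \<alpha>" using assms by simp_all
  have "0 \<le> cos (pi * \<alpha>)" "0 \<le> sin (pi * \<alpha>)"
    by (rule cos_ge_zero sin_ge_zero; use a1 a2 pi_gt_zero in linarith)+
  then have c: "0 \<le> c" and s: "0 \<le> s"
    using assms by (auto simp: c_def s_def)
  have "exp (-c) * sin s \<le> exp (-c) * s"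
    using s by (intro mult_left_mono sin_x_le_x) auto
  also have "\<dots> \<le> 1 * s"
    using c s by (intro mult_right_mono) auto
  finally show ?thesis by (simp add: spectral_kernel_def c_def s_def)
qed

lemma Re_powr_nonneg:
  fixes w :: complex
  assumes "0 < Re w" "0 \<le> \<beta>" "\<beta> \<le> 1"
  shows "0 \<le> Re (w powr of_real \<beta>)"
proof -
  have "\<bar>Im (Ln w)\<bar> < pi / 2"
    using assms(1) Re_Ln_pos_lt[of w] by (cases "w = 0") auto
  then have "\<bar>\<beta> * Im (Ln w)\<bar> \<le> 1 * (pi / 2)"
    unfolding abs_mult using assms(2,3) by (intro mult_mono) auto
  then have "0 \<le> cos (\<beta> * Im (Ln w))"
    by (intro cos_ge_zero) linarith+
  then show ?thesis by (auto simp: powr_def Re_exp)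
qed

text \<open>The mean value property of \<open>F \<circ> W\<close> at \<open>0\<close>, where \<open>W\<close> maps the unit disc onto the right
  half-plane, with \<open>W 0 = 1\<close>, and \<open>F w = (exp (- X w powr (2 \<alpha>)) - 1 + X w powr (2 \<alpha>)) / w\<close>. The
  point \<open>exp (\<i> \<theta>)\<close> of the unit circle goes to \<open>- \<i> tan (\<theta>/2)\<close>. The radius is sent to \<open>1\<close> by
  dominated convergence. The factor \<open>1 / w\<close> turns the real part of \<open>F\<close> on the imaginary axis
  into an imaginary part of the numerator, which is what has a sign.\<close>
lemma integral_angle_spectral_kernel:
  assumes \<alpha>: "0 < \<alpha>" "\<alpha> \<le> 1/2" and X: "0 < X"
  shows "((\<lambda>\<theta>. spectral_kernel \<alpha> X ((tan (\<theta>/2))\<^sup>2) / tan (\<theta>/2))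
           has_integral (pi * (exp (-X) - 1 + X))) {0<..<pi}"
proof -
  define \<beta> where "\<beta> = 2 * \<alpha>"
  have \<beta>: "0 < \<beta>" "\<beta> \<le> 1" using \<alpha> by (auto simp: \<beta>_def)
  define F :: "complex \<Rightarrow> complex" where
    "F w = (exp (- (of_real X * w powr of_real \<beta>)) - 1 + of_real X * w powr of_real \<beta>) / w" for w
  define W :: "complex \<Rightarrow> complex" where "W z = (1 - z) / (1 + z)" for z
  define \<rho> where "\<rho> k = 1 - 1 / real (Suc (Suc k))" for k
  have \<rho>: "1/2 \<le> \<rho> k" "\<rho> k < 1" "0 < \<rho> k" for k
    by (auto simp: \<rho>_def field_simps)
  have plus_nz: "1 + z \<noteq> 0" if "norm z < 1" for z :: complex
    using that by (metis add.commute add_eq_0_iff norm_minus_cancel norm_one order_less_irrefl)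
  have ReW: "0 < Re (W z)" if "norm z < 1" for z
  proof -
    have "Re (W z) = (1 - (norm z)\<^sup>2) / (norm (1 + z))\<^sup>2"
      unfolding W_def Re_divide cmod_power2
      by (simp add: power2_eq_square algebra_simps)
    moreover have "(norm z)\<^sup>2 < 1" using that by (simp add: power_less_one_iff abs_square_less_1)
    ultimately show ?thesis using plus_nz[OF that] by simp
  qed
  have holF: "F holomorphic_on {w. 0 < Re w}"
    unfolding F_def by (intro holomorphic_intros) (auto simp: complex_nonpos_Reals_iff)
  have holW: "W holomorphic_on ball 0 1"
    unfolding W_def using plus_nz by (intro holomorphic_intros) auto
  have hol: "(F \<circ> W) holomorphic_on ball 0 1"
    by (rule holomorphic_on_compose_gen[OF holW holF]) (use ReW in auto)
  have sym: "(F \<circ> W) (cnj z) = cnj ((F \<circ> W) z)" if "z \<in> ball 0 1" for z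
  proof -
    have "cnj (W z powr of_real \<beta>) = cnj (W z) powr of_real \<beta>"
      using ReW[of z] that by (subst cnj_powr) auto
    moreover have "W (cnj z) = cnj (W z)" by (simp add: W_def)
    ultimately show ?thesis by (simp add: F_def exp_cnj)
  qed
  have F0: "(F \<circ> W) 0 = of_real (exp (-X) - 1 + X)"
    by (simp add: F_def W_def exp_of_real flip: of_real_minus)
  define f where "f k \<theta> = Re ((F \<circ> W) (of_real (\<rho> k) * cis \<theta>))" for k \<theta>
  have I: "(f k has_integral (pi * (exp (-X) - 1 + X))) {0<..<pi}" for k
    using mean_value_half_circle[OF hol \<rho>(3,2) sym, of k] F0
    by (simp add: f_def[abs_def] has_integral_Icc_iff_Ioo)
  \<comment> \<open>The bound \<open>2 X \<bar>w\<bar> powr (\<beta> - 1)\<close> can be large only near \<open>w = 0\<close>, which corresponds to \<open>\<theta> = 0\<close>;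
    \<open>\<bar>w\<bar>\<close> is at least \<open>\<theta>/8\<close>, uniformly in the radii \<open>\<rho> k \<ge> 1/2\<close>, so an integrable multiple of
    \<open>\<theta> powr (\<beta> - 1)\<close> dominates.\<close>
  have boundF: "norm (F w) \<le> 2 * X * norm w powr (\<beta> - 1)" if "0 < Re w" for w
  proof -
    let ?u = "of_real X * w powr of_real \<beta>"
    have "0 \<le> Re ?u" using Re_powr_nonneg[OF that, of \<beta>] \<beta> X by simp
    then have "norm (exp (- ?u) - 1 + ?u) \<le> norm ?u + norm ?u"
      by (intro norm_triangle_mono norm_exp_minus_le) auto
    also have "norm ?u = X * norm w powr \<beta>"
      using X by (simp add: norm_mult norm_powr_real_powr')
    finally have *: "norm (exp (- ?u) - 1 + ?u) \<le> 2 * X * norm w powr \<beta>" by simp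
    have w: "norm w > 0" using that by auto
    have "norm (F w) = norm (exp (- ?u) - 1 + ?u) / norm w"
      by (simp add: F_def norm_divide)
    also have "\<dots> \<le> 2 * X * norm w powr \<beta> / norm w"
      using * w by (intro divide_right_mono) auto
    also have "\<dots> = 2 * X * norm w powr (\<beta> - 1)"
      using w by (simp add: powr_diff)
    finally show ?thesis .
  qed
  have lower: "\<theta> / 8 \<le> norm (W (of_real (\<rho> k) * cis \<theta>))" if "\<theta> \<in> {0<..<pi}" for k \<theta>
  proof -
    let ?z = "of_real (\<rho> k) * cis \<theta>"
    have nz: "norm ?z < 1" using \<rho>[of k] by (simp add: norm_mult)
    have "2 * (\<theta>/2) / pi \<le> sin (\<theta>/2)"
      using that by (intro Jordan_sin_ge) auto
    moreover have "\<theta> / 4 \<le> 2 * (\<theta>/2) / pi"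
      using that pi_less_4 by (simp add: field_simps)
    ultimately have "\<theta>/4 \<le> sin (\<theta>/2)" by linarith
    then have s: "(\<theta>/4)\<^sup>2 \<le> (sin (\<theta>/2))\<^sup>2"
      using that by (intro power_mono) auto
    have c: "cos \<theta> = 1 - 2 * (sin (\<theta>/2))\<^sup>2"
      using cos_double_sin[of "\<theta>/2"] by simp
    have n: "(norm (1 - ?z))\<^sup>2 = 1 - 2 * \<rho> k * cos \<theta> + (\<rho> k)\<^sup>2"
    proof -
      have "(1 - r * c)\<^sup>2 + (r * s)\<^sup>2 = 1 - 2 * r * c + r\<^sup>2 * (s\<^sup>2 + c\<^sup>2)" for r c s :: real
        by (simp add: power2_eq_square algebra_simps)
      from this[of "\<rho> k" "cos \<theta>" "sin \<theta>"] show ?thesis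
        unfolding cmod_power2 by simp
    qed
    have "(norm (1 - ?z))\<^sup>2 = (1 - \<rho> k)\<^sup>2 + 4 * \<rho> k * (sin (\<theta>/2))\<^sup>2"
      unfolding n c by (simp add: power2_eq_square algebra_simps)
    moreover have "(1/2) * (sin (\<theta>/2))\<^sup>2 \<le> \<rho> k * (sin (\<theta>/2))\<^sup>2"
      using \<rho>[of k] by (intro mult_right_mono) auto
    moreover have "0 \<le> (1 - \<rho> k)\<^sup>2" by simp
    moreover have "0 \<le> (sin (\<theta>/2))\<^sup>2" by simp
    ultimately have "(\<theta>/4)\<^sup>2 \<le> (norm (1 - ?z))\<^sup>2"
      using s by linarith
    then have 1: "\<theta>/4 \<le> norm (1 - ?z)" by (rule power2_le_imp_le) simp
    have 2: "norm (1 + ?z) \<le> 2"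
      using norm_triangle_ineq[of 1 ?z] nz by simp
    have 3: "0 < norm (1 + ?z)" using plus_nz[OF nz] by simp
    have "\<theta> / 8 = (\<theta>/4) / 2" by simp
    also have "\<dots> \<le> norm (1 - ?z) / norm (1 + ?z)"
      using 1 2 3 that by (intro frac_le) auto
    finally show ?thesis by (simp add: W_def norm_divide)
  qed
  have dom: "norm (f k \<theta>) \<le> 2 * X * (8 powr (1 - \<beta>) * \<theta> powr (\<beta> - 1))" if "\<theta> \<in> {0<..<pi}" for k \<theta>
  proof -
    let ?z = "of_real (\<rho> k) * cis \<theta>"
    have nz: "norm ?z < 1" using \<rho>[of k] by (simp add: norm_mult)
    have "norm (f k \<theta>) \<le> norm (F (W ?z))"
      unfolding f_def o_def real_norm_def by (rule abs_Re_le_cmod)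
    also have "\<dots> \<le> 2 * X * norm (W ?z) powr (\<beta> - 1)"
      by (rule boundF[OF ReW[OF nz]])
    also have "\<dots> \<le> 2 * X * (\<theta>/8) powr (\<beta> - 1)"
      using lower[OF that, of k] that X \<beta> by (intro mult_left_mono powr_mono2') auto
    also have "(\<theta>/8) powr (\<beta> - 1) = 8 powr (1 - \<beta>) * \<theta> powr (\<beta> - 1)"
      using that powr_minus_divide[of 8 "\<beta> - 1"] by (simp add: powr_divide)
    finally show ?thesis .
  qed
  have int: "(\<lambda>\<theta>. 2 * X * (8 powr (1 - \<beta>) * \<theta> powr (\<beta> - 1))) integrable_on {0<..<pi}"
    using integrable_on_powr_from_0[of "\<beta> - 1" pi] \<beta>
    by (intro integrable_on_mult_right) (simp add: integrable_on_Icc_iff_Ioo)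
  have \<rho>lim: "\<rho> \<longlonglongrightarrow> 1"
    using LIMSEQ_Suc[OF LIMSEQ_inverse_real_of_nat_add_minus[of 1]]
    by (simp add: \<rho>_def[abs_def] inverse_eq_divide)
  have lim: "(\<lambda>k. f k \<theta>) \<longlonglongrightarrow> spectral_kernel \<alpha> X ((tan (\<theta>/2))\<^sup>2) / tan (\<theta>/2)"
    if \<theta>: "\<theta> \<in> {0<..<pi}" for \<theta>
  proof -
    define \<tau> where "\<tau> = tan (\<theta>/2)"
    have \<tau>: "0 < \<tau>" unfolding \<tau>_def using \<theta> by (intro tan_gt_zero) auto
    have c: "0 < cos (\<theta>/2)" using \<theta> by (intro cos_gt_zero) auto
    have cs: "cis \<theta> = Complex (2 * (cos (\<theta>/2))\<^sup>2 - 1) (2 * sin (\<theta>/2) * cos (\<theta>/2))"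
      using cos_double_cos[of "\<theta>/2"] sin_double[of "\<theta>/2"] by (simp add: complex_eq_iff)
    have nz: "1 + cis \<theta> \<noteq> 0"
      using c by (simp add: cs complex_eq_iff)
    have W1: "W (cis \<theta>) = - \<i> * of_real \<tau>"
    proof -
      have "1 - cis \<theta> = - \<i> * of_real \<tau> * (1 + cis \<theta>)"
      proof -
        have "2 * (cos (\<theta>/2))\<^sup>2 * \<tau> = 2 * sin (\<theta>/2) * cos (\<theta>/2)"
          using c by (simp add: \<tau>_def tan_def power2_eq_square)
        moreover have "2 * sin (\<theta>/2) * cos (\<theta>/2) * \<tau> = 2 - 2 * (cos (\<theta>/2))\<^sup>2"
          using c sin_squared_eq[of "\<theta>/2"] by (simp add: \<tau>_def tan_def power2_eq_square)
        ultimately show ?thesis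
          by (simp add: cs complex_eq_iff algebra_simps)
      qed
      then show ?thesis using nz by (simp add: W_def field_simps)
    qed
    have "(\<lambda>k. W (of_real (\<rho> k) * cis \<theta>)) \<longlonglongrightarrow> (1 - of_real 1 * cis \<theta>) / (1 + of_real 1 * cis \<theta>)"
      unfolding W_def by (intro tendsto_intros \<rho>lim) (use nz in auto)
    then have Wlim: "(\<lambda>k. W (of_real (\<rho> k) * cis \<theta>)) \<longlonglongrightarrow> - \<i> * of_real \<tau>"
      using W1 by (simp add: W_def)
    have "isCont F (- \<i> * of_real \<tau>)"
      unfolding F_def using \<tau> by (intro continuous_intros) (auto simp: complex_nonpos_Reals_iff)
    from isCont_tendsto_compose[OF this Wlim]
    have "(\<lambda>k. f k \<theta>) \<longlonglongrightarrow> Re (F (- \<i> * of_real \<tau>))"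
      unfolding f_def o_def by (rule tendsto_Re)
    moreover have "Re (F (- \<i> * of_real \<tau>)) = spectral_kernel \<alpha> X (\<tau>\<^sup>2) / \<tau>"
    proof -
      define p where "p = X * \<tau> powr \<beta>"
      have L: "Ln (- \<i> * of_real \<tau>) = of_real (ln \<tau>) + of_real (- pi/2) * \<i>"
        using Ln_times_of_real[OF \<tau>, of "-\<i>"] \<tau> by (simp add: mult.commute Ln_of_real)
      have "(- \<i> * of_real \<tau>) powr of_real \<beta> = exp (of_real \<beta> * Ln (- \<i> * of_real \<tau>))"
        using \<tau> by (simp add: powr_def)
      also have "\<dots> = exp (of_real (\<beta> * ln \<tau>) + \<i> * of_real (- pi * \<alpha>))"
        unfolding L by (simp add: \<beta>_def algebra_simps)
      also have "\<dots> = of_real (\<tau> powr \<beta>) * cis (- pi * \<alpha>)"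
        using \<tau> by (simp only: exp_add cis_conv_exp exp_of_real) (simp add: powr_def)
      finally have "of_real X * (- \<i> * of_real \<tau>) powr of_real \<beta> = of_real p * cis (- (pi * \<alpha>))"
        by (simp add: p_def)
      then have F: "F (- \<i> * of_real \<tau>)
          = (exp (- (of_real p * cis (- (pi * \<alpha>)))) - 1 + of_real p * cis (- (pi * \<alpha>))) / (- \<i> * of_real \<tau>)"
        by (simp only: F_def)
      have pw: "(\<tau>\<^sup>2) powr \<alpha> = \<tau> powr \<beta>"
        using \<tau> by (simp add: \<beta>_def powr_powr flip: powr_numeral)
      have "Re (v / (- \<i> * of_real \<tau>)) = - Im v / \<tau>" for v
        using \<tau> by (simp add: Re_divide power2_eq_square)
      then show ?thesis
        unfolding F spectral_kernel_def pw p_def[symmetric] mult.assoc[symmetric]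
        by (simp add: Im_exp diff_divide_distrib add_divide_distrib algebra_simps)
    qed
    ultimately show ?thesis by (simp add: \<tau>_def)
  qed
  show ?thesis
  proof (rule has_integral_dominated_convergence[where f=f, OF I int])
    show "\<forall>\<theta>\<in>{0<..<pi}. norm (f k \<theta>) \<le> 2 * X * (8 powr (1 - \<beta>) * \<theta> powr (\<beta> - 1))" for k
      using dom by blast
    show "\<forall>\<theta>\<in>{0<..<pi}. (\<lambda>k. f k \<theta>) \<longlonglongrightarrow> spectral_kernel \<alpha> X ((tan (\<theta>/2))\<^sup>2) / tan (\<theta>/2)"
      using lim by blast
  qed (rule tendsto_const)
qed

text \<open>The substitution \<open>r = tan\<^sup>2 (\<theta>/2)\<close>, for which \<open>dr = tan (\<theta>/2) (1 + tan\<^sup>2 (\<theta>/2)) d\<theta>\<close>.\<close>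
lemma integral_spectral_kernel:
  assumes \<alpha>: "0 < \<alpha>" "\<alpha> \<le> 1/2" and X: "0 < X"
  shows "((\<lambda>r. spectral_kernel \<alpha> X r / (r * (1 + r)))
           has_integral (pi * (exp (-X) - 1 + X))) {0<..}"
proof -
  define g where "g \<theta> = (tan (\<theta>/2))\<^sup>2" for \<theta> :: real
  define f where "f r = spectral_kernel \<alpha> X r / (r * (1 + r))" for r
  define g' where "g' \<theta> = tan (\<theta>/2) * (1 + (tan (\<theta>/2))\<^sup>2)" for \<theta> :: real
  define I where "I = pi * (exp (-X) - 1 + X)"
  have tan_pos: "0 < tan (\<theta>/2)" if "\<theta> \<in> {0<..<pi}" for \<theta>
    using that by (intro tan_gt_zero) auto
  have eq: "\<bar>g' \<theta>\<bar> * f (g \<theta>) = spectral_kernel \<alpha> X ((tan (\<theta>/2))\<^sup>2) / tan (\<theta>/2)"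
    if "\<theta> \<in> {0<..<pi}" for \<theta>
  proof -
    have "\<bar>t * (1 + t\<^sup>2)\<bar> * (K / (t\<^sup>2 * (1 + t\<^sup>2))) = K / t" if "0 < t" for t K :: real
    proof -
      have "0 < 1 + t\<^sup>2" by (rule add_pos_nonneg) auto
      then show ?thesis using that by (simp add: abs_mult power2_eq_square)
    qed
    from this[OF tan_pos[OF that]] show ?thesis by (simp add: g'_def f_def g_def)
  qed
  have H: "((\<lambda>\<theta>. \<bar>g' \<theta>\<bar> * f (g \<theta>)) has_integral I) {0<..<pi}"
    using integral_angle_spectral_kernel[OF assms] unfolding I_def
    by (rule has_integral_eq[rotated]) (use eq in auto)
  have "(\<lambda>\<theta>. \<bar>g' \<theta>\<bar> * f (g \<theta>)) absolutely_integrable_on {0<..<pi}"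
  proof (rule nonnegative_absolutely_integrable_1)
    show "(\<lambda>\<theta>. \<bar>g' \<theta>\<bar> * f (g \<theta>)) integrable_on {0<..<pi}" using H by blast
    show "0 \<le> \<bar>g' \<theta>\<bar> * f (g \<theta>)" if "\<theta> \<in> {0<..<pi}" for \<theta>
      unfolding eq[OF that] using tan_pos[OF that] spectral_kernel_nonneg[OF \<alpha>, of X] X by simp
  qed
  moreover have "integral {0<..<pi} (\<lambda>\<theta>. \<bar>g' \<theta>\<bar> * f (g \<theta>)) = I"
    using H by (rule integral_unique)
  moreover have "(g has_field_derivative g' \<theta>) (at \<theta> within {0<..<pi})" if "\<theta> \<in> {0<..<pi}" for \<theta>
  proof -
    have c: "cos (\<theta>/2) \<noteq> 0" using that cos_gt_zero[of "\<theta>/2"] by auto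
    have "1 + (tan (\<theta>/2))\<^sup>2 = inverse ((cos (\<theta>/2))\<^sup>2)"
      using tan_sec[OF c] by (simp add: power_inverse)
    then show ?thesis
      unfolding g_def g'_def using c by (simp only:) (auto intro!: derivative_eq_intros)
  qed
  moreover have "inj_on g {0<..<pi}"
  proof (rule inj_onI)
    fix s t assume st: "s \<in> {0<..<pi}" "t \<in> {0<..<pi}" "g s = g t"
    then have "tan (s/2) = tan (t/2)"
      using tan_pos[OF st(1)] tan_pos[OF st(2)] by (simp add: g_def power2_eq_iff_nonneg)
    moreover have "arctan (tan (s/2)) = s/2" "arctan (tan (t/2)) = t/2"
      by (rule arctan_tan; use st(1,2) in auto)+
    ultimately have "s/2 = t/2" by metis
    then show "s = t" by simp
  qed
  ultimately have *: "f absolutely_integrable_on g ` {0<..<pi}" "integral (g ` {0<..<pi}) f = I"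
    using has_absolute_integral_change_of_variables_1'[of "{0<..<pi}" g g' f I] by auto
  have "g ` {0<..<pi} = {0<..}"
  proof (intro equalityI subsetI)
    fix r :: real assume "r \<in> {0<..}"
    then have r: "0 < r" by simp
    have "g (2 * arctan (sqrt r)) = r" using r by (simp add: g_def tan_arctan)
    moreover have "2 * arctan (sqrt r) \<in> {0<..<pi}"
      using r arctan_ubound[of "sqrt r"] by simp
    ultimately show "r \<in> g ` {0<..<pi}" by (metis imageI)
  qed (use tan_pos in \<open>fastforce simp: g_def\<close>)
  then show ?thesis
    using integrable_integral[OF set_lebesgue_integral_eq_integral(1)[OF *(1)]] *(2)
    by (simp add: f_def[abs_def] I_def)
qed

section \<open>Bernstein functions with a jump density\<close>

text \<open>On \<open>q > 0\<close> the function \<open>f\<close> is the pure-jump Bernstein function whose measure has density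
  \<open>\<nu>\<close> with respect to Lebesgue measure on the open half-line. Both the density and the integral are
  extended nonnegative, so that the equation itself forces the integral to be finite and Tonelli's
  theorem applies freely.\<close>

definition jump_density :: "(real \<Rightarrow> real) \<Rightarrow> (real \<Rightarrow> ennreal) \<Rightarrow> bool" where
  "jump_density f \<nu> \<longleftrightarrow> \<nu> \<in> borel_measurable borel \<and>
     (\<forall>q>0. 0 \<le> f q \<and>
        ennreal (f q) = (\<integral>\<^sup>+y\<in>{0<..}. (ennreal (1 - exp (- q * y)) * \<nu> y) \<partial>lborel))"

lemma jump_density_measurable: "jump_density f \<nu> \<Longrightarrow> \<nu> \<in> borel_measurable borel"
  by (simp add: jump_density_def)

text \<open>By this bound the finiteness of the integral of \<open>1 - exp (- y)\<close> implies the integrability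
  condition on the measure of a Bernstein function.\<close>
lemma min_one_le_exp:
  fixes y :: real
  assumes "0 \<le> y"
  shows "min y 1 \<le> 2 * (1 - exp (- y))"
proof -
  have "1 + y \<le> exp y" by (rule exp_ge_add_one_self)
  then have "exp (- y) \<le> 1 / (1 + y)"
    using assms by (simp add: exp_minus field_simps)
  then have "2 * y / (1 + y) \<le> 2 * (1 - exp (- y))"
    using assms by (simp add: field_simps)
  moreover have "min y 1 \<le> 2 * y / (1 + y)"
  proof (cases "y \<le> 1")
    case True
    then have "y * y \<le> y * 1" using assms by (intro mult_left_mono) auto
    with True assms show ?thesis by (simp add: field_simps)
  next
    case False
    then show ?thesis by (simp add: field_simps)
  qed
  ultimately show ?thesis by linarith
qed

lemma jump_density_imp_B2:
  assumes g: "jump_density g \<nu>" and b: "0 \<le> b" and f: "\<And>q. q > 0 \<Longrightarrow> f q = b * q + g q"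
  shows "f \<in> B2"
proof -
  note [measurable] = jump_density_measurable[OF g]
  define \<Lambda> where "\<Lambda> = density (restrict_space lborel {0<..}) \<nu>"
  have sets: "sets \<Lambda> = sets pos_reals"
    by (simp add: \<Lambda>_def pos_reals_def sets_restrict_space)
  have sp: "space \<Lambda> = {0<..}"
    by (simp add: \<Lambda>_def space_restrict_space)
  have meas: "h \<in> borel_measurable \<Lambda>" if "h \<in> borel_measurable borel" for h :: "real \<Rightarrow> real"
    using that by (auto simp: \<Lambda>_def intro!: measurable_restrict_space1)
  have nn: "(\<integral>\<^sup>+y. h y \<partial>\<Lambda>) = (\<integral>\<^sup>+y\<in>{0<..}. (h y * \<nu> y) \<partial>lborel)"
    if [measurable]: "h \<in> borel_measurable borel" for h :: "real \<Rightarrow> ennreal"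
  proof -
    have "(\<integral>\<^sup>+y. h y \<partial>\<Lambda>) = (\<integral>\<^sup>+y. \<nu> y * h y \<partial>restrict_space lborel {0<..})"
      unfolding \<Lambda>_def by (intro nn_integral_density measurable_restrict_space1) auto
    then show ?thesis by (simp add: nn_integral_restrict_space mult.commute)
  qed
  have g_eq: "ennreal (g q) = (\<integral>\<^sup>+y. ennreal (1 - exp (- q * y)) \<partial>\<Lambda>)" if "q > 0" for q
    using g that by (subst nn) (auto simp: jump_density_def)
  have "(\<integral>\<^sup>+y. ennreal (min y 1) \<partial>\<Lambda>) \<le> (\<integral>\<^sup>+y. 2 * ennreal (1 - exp (- 1 * y)) \<partial>\<Lambda>)"
  proof (rule nn_integral_mono)
    fix y assume "y \<in> space \<Lambda>"
    then have "ennreal (min y 1) \<le> ennreal (2 * (1 - exp (- 1 * y)))"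
      using min_one_le_exp[of y] by (intro ennreal_leI) (simp add: sp)
    then show "ennreal (min y 1) \<le> 2 * ennreal (1 - exp (- 1 * y))"
      unfolding ennreal_mult'[OF zero_le_numeral] ennreal_numeral .
  qed
  also have "\<dots> = 2 * ennreal (g 1)"
    by (subst nn_integral_cmult) (auto simp: g_eq intro!: measurable_compose[OF meas])
  also have "\<dots> < \<infinity>" by (simp add: ennreal_mult_less_top)
  finally have "bernstein_measure \<Lambda>"
    using sets by (simp add: bernstein_measure_def)
  moreover have "f q = bernstein_fun 0 b \<Lambda> q" if q: "q > 0" for q
  proof -
    have "(\<integral>y. (1 - exp (- q * y)) \<partial>\<Lambda>) = enn2real (\<integral>\<^sup>+y. ennreal (1 - exp (- q * y)) \<partial>\<Lambda>)"
      using q by (intro integral_eq_nn_integral meas AE_I2) (auto simp: sp)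
    also have "\<dots> = g q" unfolding g_eq[OF q, symmetric] using g q
      by (intro enn2real_ennreal) (simp add: jump_density_def)
    finally show ?thesis using f[OF q] by (simp add: bernstein_fun_def)
  qed
  ultimately show ?thesis using b by (auto simp: B2_def)
qed

lemma jump_density_add:
  assumes f: "jump_density f \<nu>" and g: "jump_density g \<kappa>"
  shows "jump_density (\<lambda>q. f q + g q) (\<lambda>y. \<nu> y + \<kappa> y)"
  unfolding jump_density_def
proof (intro conjI allI impI)
  note [measurable] = jump_density_measurable[OF f] jump_density_measurable[OF g]
  show "(\<lambda>y. \<nu> y + \<kappa> y) \<in> borel_measurable borel" by measurable
  fix q :: real assume q: "0 < q"
  show "0 \<le> f q + g q" using f g q by (simp add: jump_density_def)
  have "ennreal (f q + g q) = ennreal (f q) + ennreal (g q)"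
    using f g q by (simp add: jump_density_def)
  also have "\<dots> = (\<integral>\<^sup>+y\<in>{0<..}. (ennreal (1 - exp (- q * y)) * \<nu> y) \<partial>lborel)
      + (\<integral>\<^sup>+y\<in>{0<..}. (ennreal (1 - exp (- q * y)) * \<kappa> y) \<partial>lborel)"
    using f g q by (simp add: jump_density_def)
  also have "\<dots> = (\<integral>\<^sup>+y\<in>{0<..}. (ennreal (1 - exp (- q * y)) * (\<nu> y + \<kappa> y)) \<partial>lborel)"
    by (subst nn_integral_add[symmetric]) (auto simp: algebra_simps)
  finally show "ennreal (f q + g q)
      = (\<integral>\<^sup>+y\<in>{0<..}. (ennreal (1 - exp (- q * y)) * (\<nu> y + \<kappa> y)) \<partial>lborel)" .
qed

lemma jump_density_cmult:
  assumes f: "jump_density f \<nu>" and c: "0 \<le> c"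
  shows "jump_density (\<lambda>q. c * f q) (\<lambda>y. ennreal c * \<nu> y)"
  unfolding jump_density_def
proof (intro conjI allI impI)
  note [measurable] = jump_density_measurable[OF f]
  show "(\<lambda>y. ennreal c * \<nu> y) \<in> borel_measurable borel" by measurable
  fix q :: real assume q: "0 < q"
  show "0 \<le> c * f q" using f c q by (simp add: jump_density_def)
  have "ennreal (c * f q) = ennreal c * (\<integral>\<^sup>+y\<in>{0<..}. (ennreal (1 - exp (- q * y)) * \<nu> y) \<partial>lborel)"
    using f c q by (simp add: jump_density_def ennreal_mult)
  also have "\<dots> = (\<integral>\<^sup>+y\<in>{0<..}. (ennreal (1 - exp (- q * y)) * (ennreal c * \<nu> y)) \<partial>lborel)"
    by (subst nn_integral_cmult[symmetric]) (auto simp: algebra_simps)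
  finally show "ennreal (c * f q)
      = (\<integral>\<^sup>+y\<in>{0<..}. (ennreal (1 - exp (- q * y)) * (ennreal c * \<nu> y)) \<partial>lborel)" .
qed

text \<open>By scaling, the integral of \<open>1 - exp (- q y)\<close> against \<open>y powr (- 1 - \<gamma>)\<close> is \<open>K q\<^sup>\<gamma>\<close>, where
  \<open>K\<close> is its value at \<open>q = 1\<close>; only \<open>0 < K < \<infinity>\<close> matters.\<close>
lemma jump_density_powr:
  assumes \<gamma>: "0 < \<gamma>" "\<gamma> < 1"
  obtains \<nu> where "jump_density (\<lambda>q. q powr \<gamma>) \<nu>"
proof -
  define h where "h y = (1 - exp (- y)) * y powr (- 1 - \<gamma>)" for y :: real
  have [measurable]: "h \<in> borel_measurable borel" unfolding h_def by measurable
  have h_nonneg: "0 \<le> h y" if "0 < y" for y using that by (simp add: h_def)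
  define K where "K = (\<integral>\<^sup>+y\<in>{0<..}. ennreal (h y) \<partial>lborel)"
  have "K \<le> (\<integral>\<^sup>+y. (ennreal (y powr (-\<gamma>)) * indicator {0..1} y
      + ennreal (y powr (- 1 - \<gamma>)) * indicator {1..} y) \<partial>lborel)"
    unfolding K_def
  proof (rule nn_integral_mono)
    fix y :: real
    have "h y \<le> y powr (-\<gamma>)" if "0 < y"
    proof -
      have "h y \<le> y * y powr (- 1 - \<gamma>)"
        unfolding h_def using exp_ge_add_one_self[of "-y"] by (intro mult_right_mono) auto
      also have "\<dots> = y powr (-\<gamma>)" using that by (simp add: powr_mult_base)
      finally show ?thesis .
    qed
    moreover have "h y \<le> y powr (- 1 - \<gamma>)" if "0 < y"
      unfolding h_def by (rule mult_left_le_one_le) (use that in auto)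
    ultimately show "ennreal (h y) * indicator {0<..} y \<le> ennreal (y powr (-\<gamma>)) * indicator {0..1} y
      + ennreal (y powr (- 1 - \<gamma>)) * indicator {1..} y"
    proof (cases "0 < y \<and> y \<le> 1")
      case True
      then have "ennreal (h y) * indicator {0<..} y \<le> ennreal (y powr (-\<gamma>)) * indicator {0..1} y"
        using \<open>0 < y \<Longrightarrow> h y \<le> y powr (-\<gamma>)\<close> by (simp add: ennreal_leI)
      then show ?thesis by (rule add_increasing2[rotated]) simp
    qed (auto simp: indicator_def intro!: ennreal_leI)
  qed
  also have "\<dots> = (\<integral>\<^sup>+y\<in>{0..1}. ennreal (y powr (-\<gamma>)) \<partial>lborel)
      + (\<integral>\<^sup>+y\<in>{1..}. ennreal (y powr (- 1 - \<gamma>)) \<partial>lborel)"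
    by (rule nn_integral_add) auto
  also have "\<dots> < \<infinity>"
    using nn_integral_has_integral_lebesgue'[OF _ has_integral_powr_from_0[of "-\<gamma>" 1]]
      nn_integral_has_integral_lebesgue'[OF _ has_integral_powr_to_inf[of "-1-\<gamma>" 1]] \<gamma>
    by (simp add: ennreal_add_less_top)
  finally have K_fin: "K < \<infinity>" .
  have "0 < ennreal ((1 - exp (- 1)) * 2 powr (- 1 - \<gamma>))" by simp
  also have "\<dots> = (\<integral>\<^sup>+y\<in>{1..2::real}. ennreal ((1 - exp (- 1)) * 2 powr (- 1 - \<gamma>)) \<partial>lborel)"
    by (subst nn_integral_cmult_indicator) auto
  also have "\<dots> \<le> K"
    unfolding K_def
  proof (rule nn_integral_mono)
    fix y :: real
    have "(1 - exp (- 1)) * 2 powr (- 1 - \<gamma>) \<le> h y" if "1 \<le> y" "y \<le> 2"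
      unfolding h_def using that \<gamma> by (intro mult_mono powr_mono2') auto
    then show "ennreal ((1 - exp (- 1)) * 2 powr (- 1 - \<gamma>)) * indicator {1..2} y
        \<le> ennreal (h y) * indicator {0<..} y"
      by (auto simp: indicator_def intro!: ennreal_leI)
  qed
  finally have K_pos: "0 < K" .
  define k where "k = enn2real K"
  have k: "K = ennreal k" "0 < k"
    using K_fin K_pos by (auto simp: k_def enn2real_positive_iff)
  have "jump_density (\<lambda>q. q powr \<gamma>) (\<lambda>y. ennreal (y powr (- 1 - \<gamma>) / k))"
    unfolding jump_density_def
  proof (intro conjI allI impI)
    fix q :: real assume q: "0 < q"
    have "(\<integral>\<^sup>+y\<in>{0<..}. (ennreal (1 - exp (- q * y)) * ennreal (y powr (- 1 - \<gamma>) / k)) \<partial>lborel)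
        = ennreal \<bar>1 / q\<bar> * (\<integral>\<^sup>+z. ennreal (1 - exp (- q * (0 + (1 / q) * z)))
            * ennreal ((0 + (1 / q) * z) powr (- 1 - \<gamma>) / k) * indicator {0<..} (0 + (1 / q) * z) \<partial>lborel)"
      using q by (intro nn_integral_real_affine) auto
    also have "\<dots> = ennreal (1 / q) * (\<integral>\<^sup>+z. ennreal (q * q powr \<gamma> / k) * (ennreal (h z) * indicator {0<..} z) \<partial>lborel)"
    proof -
      have "ennreal (1 - exp (- q * (0 + (1 / q) * z)))
            * ennreal ((0 + (1 / q) * z) powr (- 1 - \<gamma>) / k) * indicator {0<..} (0 + (1 / q) * z)
          = ennreal (q * q powr \<gamma> / k) * (ennreal (h z) * indicator {0<..} z)" for z
      proof (cases "0 < z")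
        case True
        have "(z / q) powr (- 1 - \<gamma>) = q * q powr \<gamma> * z powr (- 1 - \<gamma>)"
          using True q by (simp add: powr_divide powr_diff powr_minus field_simps)
        then have "(1 - exp (- z)) * ((z / q) powr (- 1 - \<gamma>) / k) = q * q powr \<gamma> / k * h z"
          by (simp add: h_def)
        then show ?thesis
          using True q k h_nonneg[OF True] by (simp flip: ennreal_mult)
      qed (use q in \<open>simp add: zero_less_divide_iff\<close>)
      then show ?thesis using q by simp
    qed
    also have "\<dots> = ennreal (1 / q) * (ennreal (q * q powr \<gamma> / k) * K)"
      unfolding K_def by (subst nn_integral_cmult) auto
    also have "\<dots> = ennreal (q powr \<gamma>)"
      using q k by (simp flip: ennreal_mult)
    finally show "ennreal (q powr \<gamma>) =
      (\<integral>\<^sup>+y\<in>{0<..}. (ennreal (1 - exp (- q * y)) * ennreal (y powr (- 1 - \<gamma>) / k)) \<partial>lborel)" ..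
  qed auto
  then show ?thesis by (rule that)
qed

section \<open>The jump density of \<open>exp (- x q\<^sup>\<alpha>) - 1 + x q\<^sup>\<alpha>\<close>\<close>

text \<open>The Laplace transform, at \<open>y\<close>, of the spectral kernel divided by \<open>\<pi>\<close>.\<close>

definition spectral_jump_density :: "real \<Rightarrow> real \<Rightarrow> real \<Rightarrow> ennreal" where
  "spectral_jump_density \<alpha> x y = (\<integral>\<^sup>+r\<in>{0<..}. ennreal (exp (- y * r) * spectral_kernel \<alpha> x r / pi) \<partial>lborel)"

lemma spectral_kernel_measurable [measurable]:
  "(\<lambda>(x, r). spectral_kernel \<alpha> x r) \<in> borel_measurable (borel \<Otimes>\<^sub>M borel)"
  unfolding spectral_kernel_def by measurable

lemma spectral_jump_density_measurable [measurable]: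
  "(\<lambda>(x, y). spectral_jump_density \<alpha> x y) \<in> borel_measurable (borel \<Otimes>\<^sub>M borel)"
  unfolding spectral_jump_density_def by measurable

lemma nn_integral_exp_diff:
  fixes q r :: real
  assumes "0 < q" "0 < r"
  shows "(\<integral>\<^sup>+y\<in>{0<..}. ennreal ((1 - exp (- q * y)) * exp (- y * r)) \<partial>lborel) = ennreal (q / (r * (r + q)))"
proof -
  have "((\<lambda>y. exp (- r * y) - exp (- (r + q) * y)) has_integral exp (- r * 0) / r - exp (- (r + q) * 0) / (r + q)) {0..}"
    using assms by (intro has_integral_diff has_integral_exp_minus_to_infinity) auto
  moreover have "(F has_integral c) {0..} \<longleftrightarrow> (F has_integral c) {0<..}" for F :: "real \<Rightarrow> real" and c
    by (rule has_integral_spike_set_eq; rule negligible_subset[of "{0}"]; force)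
  ultimately have "((\<lambda>y. exp (- r * y) - exp (- (r + q) * y)) has_integral exp (- r * 0) / r - exp (- (r + q) * 0) / (r + q)) {0<..}"
    by blast
  moreover have "exp (- r * 0) / r - exp (- (r + q) * 0) / (r + q) = q / (r * (r + q))"
    using assms by (simp add: field_simps)
  moreover have "exp (- r * y) - exp (- (r + q) * y) = (1 - exp (- q * y)) * exp (- y * r)" for y
    by (simp add: algebra_simps exp_add[symmetric])
  ultimately have "((\<lambda>y. (1 - exp (- q * y)) * exp (- y * r)) has_integral q / (r * (r + q))) {0<..}"
    by simp
  then show ?thesis
    using assms by (intro nn_integral_has_integral_lebesgue') auto
qed

text \<open>The case \<open>q = 1\<close> is the integral computed above; the general case follows by scaling, since
  the kernel depends on \<open>x\<close> and \<open>r\<close> only through \<open>x r\<^sup>\<alpha>\<close>.\<close>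
lemma spectral_representation:
  assumes \<alpha>: "0 < \<alpha>" "\<alpha> \<le> 1/2" and x: "0 < x" and q: "0 < q"
  shows "ennreal (exp (- (q powr \<alpha>) * x) - 1 + q powr \<alpha> * x)
    = (\<integral>\<^sup>+r\<in>{0<..}. ennreal (q / (r * (r + q)) * (spectral_kernel \<alpha> x r / pi)) \<partial>lborel)"
proof -
  define X where "X = x * q powr \<alpha>"
  have X: "0 < X" using x q by (simp add: X_def)
  define m where "m = spectral_kernel \<alpha> x"
  have [measurable]: "m \<in> borel_measurable borel"
    unfolding m_def spectral_kernel_def by measurable
  have scale: "spectral_kernel \<alpha> X r = m (q * r)" if "0 < r" for r
    using q that by (simp add: spectral_kernel_def m_def X_def powr_mult mult.assoc)
  have "((\<lambda>r. spectral_kernel \<alpha> X r / (r * (1 + r)) / pi) has_integral (pi * (exp (-X) - 1 + X)) / pi) {0<..}"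
    by (intro has_integral_divide integral_spectral_kernel \<alpha> X)
  then have "(\<integral>\<^sup>+r\<in>{0<..}. ennreal (spectral_kernel \<alpha> X r / (r * (1 + r)) / pi) \<partial>lborel)
      = ennreal ((pi * (exp (-X) - 1 + X)) / pi)"
    using spectral_kernel_nonneg[OF \<alpha>, of X] X by (intro nn_integral_has_integral_lebesgue') auto
  then have "ennreal (exp (-X) - 1 + X)
      = (\<integral>\<^sup>+r\<in>{0<..}. ennreal (spectral_kernel \<alpha> X r / (r * (1 + r)) / pi) \<partial>lborel)"
    by simp
  also have "\<dots> = (\<integral>\<^sup>+r. ennreal q * (ennreal (q / ((0 + q * r) * ((0 + q * r) + q)) * (m (0 + q * r) / pi))
      * indicator {0<..} (0 + q * r)) \<partial>lborel)"
  proof (rule nn_integral_cong)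
    fix r :: real
    show "ennreal (spectral_kernel \<alpha> X r / (r * (1 + r)) / pi) * indicator {0<..} r
      = ennreal q * (ennreal (q / ((0 + q * r) * ((0 + q * r) + q)) * (m (0 + q * r) / pi))
      * indicator {0<..} (0 + q * r))"
    proof (cases "0 < r")
      case True
      have "q * r * (q * r + q) = q * (q * (r * (1 + r)))" by (simp add: algebra_simps)
      then have "q / (q * r * (q * r + q)) = q / (q * (q * (r * (1 + r))))" by (simp only:)
      also have "\<dots> = 1 / (r * (1 + r)) / q" using q by simp
      finally have "q / (q * r * (q * r + q)) = 1 / (r * (1 + r)) / q" .
      moreover have "m (q * r) / (r * (1 + r)) / pi = q * (1 / (r * (1 + r)) / q * (m (q * r) / pi))"
        using q by simp
      ultimately have "m (q * r) / (r * (1 + r)) / pi = q * (q / (q * r * (q * r + q)) * (m (q * r) / pi))"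
        by (simp only:)
      then show ?thesis
        using True q by (simp add: scale ennreal_mult'[symmetric])
    qed (use q in \<open>simp add: zero_less_mult_iff\<close>)
  qed
  also have "\<dots> = ennreal \<bar>q\<bar> * (\<integral>\<^sup>+r. (ennreal (q / ((0 + q * r) * ((0 + q * r) + q)) * (m (0 + q * r) / pi))
      * indicator {0<..} (0 + q * r)) \<partial>lborel)"
    using q by (subst nn_integral_cmult) auto
  also have "\<dots> = (\<integral>\<^sup>+r. ennreal (q / (r * (r + q)) * (m r / pi)) * indicator {0<..} r \<partial>lborel)"
    using q by (intro nn_integral_real_affine[symmetric]) auto
  finally show ?thesis by (simp add: X_def m_def mult.commute)
qed

lemma jump_density_exp_powr:
  assumes \<alpha>: "0 < \<alpha>" "\<alpha> \<le> 1/2" and x: "0 < x"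
  shows "jump_density (\<lambda>q. exp (- (q powr \<alpha>) * x) - 1 + q powr \<alpha> * x) (spectral_jump_density \<alpha> x)"
  unfolding jump_density_def
proof (intro conjI allI impI)
  show "spectral_jump_density \<alpha> x \<in> borel_measurable borel"
    unfolding spectral_jump_density_def spectral_kernel_def by measurable
  fix q :: real assume q: "0 < q"
  show "0 \<le> exp (- (q powr \<alpha>) * x) - 1 + q powr \<alpha> * x"
    using exp_ge_add_one_self[of "- (q powr \<alpha>) * x"] by simp
  define m where "m = spectral_kernel \<alpha> x"
  have m: "0 \<le> m r" for r using spectral_kernel_nonneg[OF \<alpha>, of x r] x by (simp add: m_def)
  have [measurable]: "m \<in> borel_measurable borel"
    unfolding m_def spectral_kernel_def by measurable
  let ?I = "indicator {0<..} :: real \<Rightarrow> ennreal"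
  have "ennreal (exp (- (q powr \<alpha>) * x) - 1 + q powr \<alpha> * x)
    = (\<integral>\<^sup>+r. ennreal (q / (r * (r + q)) * (m r / pi)) * ?I r \<partial>lborel)"
    using spectral_representation[OF \<alpha> x q] by (simp add: m_def)
  also have "\<dots> = (\<integral>\<^sup>+r. (\<integral>\<^sup>+y. ennreal (1 - exp (- q * y)) * ennreal (exp (- y * r) * m r / pi) * ?I y * ?I r \<partial>lborel) \<partial>lborel)"
  proof (rule nn_integral_cong)
    fix r :: real
    show "ennreal (q / (r * (r + q)) * (m r / pi)) * ?I r
      = (\<integral>\<^sup>+y. ennreal (1 - exp (- q * y)) * ennreal (exp (- y * r) * m r / pi) * ?I y * ?I r \<partial>lborel)"
    proof (cases "0 < r")
      case True
      have "(\<integral>\<^sup>+y. ennreal (1 - exp (- q * y)) * ennreal (exp (- y * r) * m r / pi) * ?I y * ?I r \<partial>lborel)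
        = (\<integral>\<^sup>+y. ennreal (m r / pi) * (ennreal ((1 - exp (- q * y)) * exp (- y * r)) * ?I y) \<partial>lborel)"
      proof (rule nn_integral_cong)
        fix y :: real
        show "ennreal (1 - exp (- q * y)) * ennreal (exp (- y * r) * m r / pi) * ?I y * ?I r
          = ennreal (m r / pi) * (ennreal ((1 - exp (- q * y)) * exp (- y * r)) * ?I y)"
          using True q m[of r]
          by (cases "0 < y") (auto simp: mult_ac simp flip: ennreal_mult)
      qed
      also have "\<dots> = ennreal (m r / pi) * ennreal (q / (r * (r + q)))"
        by (subst nn_integral_cmult) (use nn_integral_exp_diff[OF q True] in auto)
      finally show ?thesis
        using True q m[of r] by (simp add: mult_ac flip: ennreal_mult)
    qed simp
  qed
  also have "\<dots> = (\<integral>\<^sup>+y. (\<integral>\<^sup>+r. ennreal (1 - exp (- q * y)) * ennreal (exp (- y * r) * m r / pi) * ?I y * ?I r \<partial>lborel) \<partial>lborel)"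
    by (rule lborel_pair.Fubini') measurable
  also have "\<dots> = (\<integral>\<^sup>+y. ennreal (1 - exp (- q * y)) * spectral_jump_density \<alpha> x y * ?I y \<partial>lborel)"
  proof (rule nn_integral_cong)
    fix y :: real
    have "(\<integral>\<^sup>+r. ennreal (1 - exp (- q * y)) * ennreal (exp (- y * r) * m r / pi) * ?I y * ?I r \<partial>lborel)
      = (\<integral>\<^sup>+r. (ennreal (1 - exp (- q * y)) * ?I y) * (ennreal (exp (- y * r) * m r / pi) * ?I r) \<partial>lborel)"
      by (simp add: mult_ac)
    also have "\<dots> = ennreal (1 - exp (- q * y)) * ?I y * spectral_jump_density \<alpha> x y"
      unfolding spectral_jump_density_def m_def[symmetric] by (rule nn_integral_cmult) measurable
    finally show "(\<integral>\<^sup>+r. ennreal (1 - exp (- q * y)) * ennreal (exp (- y * r) * m r / pi) * ?I y * ?I r \<partial>lborel)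
      = ennreal (1 - exp (- q * y)) * spectral_jump_density \<alpha> x y * ?I y"
      by (simp add: mult_ac)
  qed
  finally show "ennreal (exp (- (q powr \<alpha>) * x) - 1 + q powr \<alpha> * x)
    = (\<integral>\<^sup>+y\<in>{0<..}. (ennreal (1 - exp (- q * y)) * spectral_jump_density \<alpha> x y) \<partial>lborel)" .
qed

section \<open>Branching mechanisms composed with a power\<close>

text \<open>Bernstein functions with jump densities may be integrated over a parameter.\<close>

lemma jump_density_mixture:
  fixes M :: "real measure"
  assumes "sigma_finite_measure M" and sets [measurable_cong]: "sets M = sets borel"
    and pos: "AE x in M. 0 < x"
    and k [measurable]: "(\<lambda>(x, y). k x y) \<in> borel_measurable (borel \<Otimes>\<^sub>M borel)"
    and g: "\<And>x. 0 < x \<Longrightarrow> jump_density (g x) (k x)"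
    and G: "\<And>q. 0 < q \<Longrightarrow> 0 \<le> G q" "\<And>q. 0 < q \<Longrightarrow> ennreal (G q) = (\<integral>\<^sup>+x. ennreal (g x q) \<partial>M)"
  shows "jump_density G (\<lambda>y. \<integral>\<^sup>+x. k x y \<partial>M)"
  unfolding jump_density_def
proof (intro conjI allI impI)
  interpret sigma_finite_measure M by fact
  interpret pair_sigma_finite M lborel ..
  show "(\<lambda>y. \<integral>\<^sup>+x. k x y \<partial>M) \<in> borel_measurable borel" by measurable
  fix q :: real assume q: "0 < q"
  show "0 \<le> G q" by (rule G(1)[OF q])
  let ?I = "indicator {0<..} :: real \<Rightarrow> ennreal"
  have "ennreal (G q) = (\<integral>\<^sup>+x. (\<integral>\<^sup>+y. ennreal (1 - exp (- q * y)) * k x y * ?I y \<partial>lborel) \<partial>M)"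
    unfolding G(2)[OF q]
    by (rule nn_integral_cong_AE) (use pos g q in \<open>auto simp: jump_density_def\<close>)
  also have "\<dots> = (\<integral>\<^sup>+y. (\<integral>\<^sup>+x. ennreal (1 - exp (- q * y)) * k x y * ?I y \<partial>M) \<partial>lborel)"
    by (rule Fubini'[symmetric]) measurable
  also have "\<dots> = (\<integral>\<^sup>+y. ennreal (1 - exp (- q * y)) * (\<integral>\<^sup>+x. k x y \<partial>M) * ?I y \<partial>lborel)"
    by (intro nn_integral_cong) (subst nn_integral_multc nn_integral_cmult; measurable)+
  finally show "ennreal (G q) = (\<integral>\<^sup>+y. ennreal (1 - exp (- q * y)) * (\<integral>\<^sup>+x. k x y \<partial>M) * ?I y \<partial>lborel)" .
qed

lemma branching_integrand_bounds:
  fixes q x :: real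
  assumes "0 < q" "0 < x"
  shows "0 \<le> exp (- q * x) - 1 + q * x"
    and "exp (- q * x) - 1 + q * x \<le> max q (q\<^sup>2) * min x (x\<^sup>2)"
proof -
  define u where "u = q * x"
  have u: "0 < u" using assms by (simp add: u_def)
  show "0 \<le> exp (- q * x) - 1 + q * x"
    using exp_ge_add_one_self[of "- q * x"] by simp
  have "u \<le> max q (q\<^sup>2) * x" unfolding u_def using assms by (intro mult_right_mono) auto
  then have "exp (- u) - 1 + u \<le> max q (q\<^sup>2) * x"
    using u exp_le_one_iff[of "- u"] by linarith
  moreover have "exp (- u) - 1 + u \<le> u\<^sup>2"
  proof -
    have "exp (- u) \<le> 1 / (1 + u)"
      using exp_ge_add_one_self[of u] u by (simp add: exp_minus field_simps)
    also have "\<dots> \<le> 1 - u + u\<^sup>2"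
      using u by (simp add: field_simps power2_eq_square)
    finally show ?thesis by simp
  qed
  moreover have "u\<^sup>2 \<le> max q (q\<^sup>2) * x\<^sup>2"
    unfolding u_def power_mult_distrib using assms by (intro mult_right_mono) auto
  ultimately show "exp (- q * x) - 1 + q * x \<le> max q (q\<^sup>2) * min x (x\<^sup>2)"
    by (simp add: u_def min_def)
qed

text \<open>The measure of a branching mechanism, extended by zero to the whole line, is
  \<open>\<sigma>\<close>-finite: it is finite on every half-line \<open>{1 / (n + 1)..}\<close>. This is what Tonelli's theorem
  needs.\<close>
lemma sigma_finite_distr_branching_measure:
  assumes "branching_measure \<mu>"
  shows "sigma_finite_measure (distr \<mu> borel (\<lambda>x. x))" and "AE x in distr \<mu> borel (\<lambda>x. x). 0 < x"
    and "(\<lambda>x. x) \<in> measurable \<mu> borel"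
proof -
  have sets: "sets \<mu> = sets (restrict_space borel {0<..})"
    using assms by (simp add: branching_measure_def pos_reals_def)
  have sp: "space \<mu> = {0<..}"
    using sets_eq_imp_space_eq[OF sets] by (simp add: space_restrict_space)
  have "(\<lambda>x. x) \<in> borel_measurable (restrict_space borel {0::real<..})"
    by (intro measurable_restrict_space1) simp
  then show m [measurable]: "(\<lambda>x. x) \<in> measurable \<mu> borel"
    by (simp add: measurable_cong_sets[OF sets refl])
  let ?M = "distr \<mu> borel (\<lambda>x. x)"
  show pos: "AE x in ?M. 0 < x"
    using sp by (subst AE_distr_iff) auto
  have fin: "(\<integral>\<^sup>+x. ennreal (min x (x\<^sup>2)) \<partial>?M) < \<infinity>"
    using assms by (subst nn_integral_distr) (auto simp: branching_measure_def)
  show "sigma_finite_measure ?M"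
  proof (rule sigma_finite_measure.intro)
    let ?A = "insert {..0} (range (\<lambda>n. {1 / real (Suc n)..}))"
    have "emeasure ?M {..0} \<noteq> \<infinity>"
    proof -
      have "emeasure ?M {..0} = 0"
        using pos by (subst (asm) AE_iff_measurable[of "{..0}"]) (auto simp: not_less)
      then show ?thesis by simp
    qed
    moreover have "emeasure ?M {1 / real (Suc n)..} \<noteq> \<infinity>" for n
    proof -
      define d where "d = (1 / real (Suc n))\<^sup>2"
      have d: "0 < d" by (simp add: d_def)
      have le: "ennreal d * indicator {1 / real (Suc n)..} x \<le> ennreal (min x (x\<^sup>2))" for x
      proof (cases "1 / real (Suc n) \<le> x")
        case True
        have "d \<le> x\<^sup>2" unfolding d_def using True by (intro power_mono) auto
        moreover have "d \<le> 1 / real (Suc n)"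
          unfolding d_def using power_decreasing[of 1 2 "1 / real (Suc n)"] by simp
        ultimately have "d \<le> min x (x\<^sup>2)" using True by simp
        then show ?thesis using True by (simp add: ennreal_leI)
      qed simp
      have "ennreal d * emeasure ?M {1 / real (Suc n)..}
          = (\<integral>\<^sup>+x. ennreal d * indicator {1 / real (Suc n)..} x \<partial>?M)"
        by (rule nn_integral_cmult_indicator[symmetric]) simp
      also have "\<dots> \<le> (\<integral>\<^sup>+x. ennreal (min x (x\<^sup>2)) \<partial>?M)"
        by (intro nn_integral_mono le)
      finally have "ennreal d * emeasure ?M {1 / real (Suc n)..} < \<infinity>" using fin by (rule order_le_less_trans)
      then show ?thesis using d by (auto simp: ennreal_mult_less_top)
    qed
    moreover have "\<Union>?A = UNIV"
    proof -
      have "x \<in> \<Union>?A" for x :: real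
      proof (cases "x \<le> 0")
        case False
        then obtain n where "inverse (real (Suc n)) < x" using reals_Archimedean[of x] by auto
        then have "x \<in> {1 / real (Suc n)..}" by (simp add: inverse_eq_divide)
        then show ?thesis by blast
      qed simp
      then show ?thesis by blast
    qed
    ultimately show "\<exists>A. countable A \<and> A \<subseteq> sets ?M \<and> \<Union> A = space ?M \<and> (\<forall>a\<in>A. emeasure ?M a \<noteq> \<infinity>)"
      by (intro exI[of _ ?A]) auto
  qed
qed

text \<open>At \<open>\<alpha> = 1/2\<close> the quadratic term of the branching mechanism becomes the drift \<open>b q\<close>;
  below, it becomes a power with exponent less than \<open>1\<close>, which has a jump density.\<close>
lemma branching_fun_powr_in_B2:
  assumes \<alpha>: "0 < \<alpha>" "\<alpha> \<le> 1/2" and a: "0 \<le> a" and b: "0 \<le> b" and \<mu>: "branching_measure \<mu>"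
    and f: "\<And>q. 0 < q \<Longrightarrow> f q = branching_fun a b \<mu> (q powr \<alpha>)"
  shows "f \<in> B2"
proof -
  define G where "G q = (\<integral>x. (exp (- (q powr \<alpha>) * x) - 1 + q powr \<alpha> * x) \<partial>\<mu>)" for q
  define M where "M = distr \<mu> borel (\<lambda>x. x)"
  note M = sigma_finite_distr_branching_measure[OF \<mu>, folded M_def]
  note [measurable] = M(3)
  have sp: "space \<mu> = {0<..}"
    using \<mu> sets_eq_imp_space_eq[of \<mu> pos_reals]
    by (simp add: branching_measure_def pos_reals_def space_restrict_space)
  have meas: "h \<in> borel_measurable \<mu>" if "h \<in> borel_measurable borel" for h :: "real \<Rightarrow> real"
    using measurable_compose[OF M(3) that] by simp
  have int: "integrable \<mu> (\<lambda>x. min x (x\<^sup>2))"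
    using \<mu> by (intro integrableI_nonneg meas AE_I2) (auto simp: branching_measure_def sp)
  have G_nonneg: "0 \<le> G q" if "0 < q" for q
    unfolding G_def using that branching_integrand_bounds(1)[of "q powr \<alpha>"]
    by (intro integral_nonneg_AE AE_I2) (auto simp: sp)
  have G_eq: "ennreal (G q) = (\<integral>\<^sup>+x. ennreal (exp (- (q powr \<alpha>) * x) - 1 + q powr \<alpha> * x) \<partial>M)" if q: "0 < q" for q
  proof -
    have q': "0 < q powr \<alpha>" using q by simp
    have "integrable \<mu> (\<lambda>x. exp (- (q powr \<alpha>) * x) - 1 + q powr \<alpha> * x)"
    proof (rule Bochner_Integration.integrable_bound)
      show "integrable \<mu> (\<lambda>x. max (q powr \<alpha>) ((q powr \<alpha>)\<^sup>2) * min x (x\<^sup>2))"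
        using int by (rule integrable_mult_right)
      show "AE x in \<mu>. norm (exp (- (q powr \<alpha>) * x) - 1 + q powr \<alpha> * x)
          \<le> norm (max (q powr \<alpha>) ((q powr \<alpha>)\<^sup>2) * min x (x\<^sup>2))"
      proof (rule AE_I2)
        fix x assume "x \<in> space \<mu>"
        then have "0 < x" by (simp add: sp)
        from branching_integrand_bounds[OF q' this]
        show "norm (exp (- (q powr \<alpha>) * x) - 1 + q powr \<alpha> * x)
          \<le> norm (max (q powr \<alpha>) ((q powr \<alpha>)\<^sup>2) * min x (x\<^sup>2))"
          unfolding real_norm_def by linarith
      qed
    qed (intro meas, measurable)
    then have "ennreal (G q) = (\<integral>\<^sup>+x. ennreal (exp (- (q powr \<alpha>) * x) - 1 + q powr \<alpha> * x) \<partial>\<mu>)"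
      unfolding G_def using branching_integrand_bounds(1)[OF q']
      by (intro nn_integral_eq_integral[symmetric] AE_I2) (auto simp: sp)
    then show ?thesis unfolding M_def by (subst nn_integral_distr) auto
  qed
  have G_jump: "jump_density G (\<lambda>y. \<integral>\<^sup>+x. spectral_jump_density \<alpha> x y \<partial>M)"
    by (rule jump_density_mixture[OF M(1) _ M(2) spectral_jump_density_measurable jump_density_exp_powr[OF \<alpha>] G_nonneg G_eq])
       (simp_all add: M_def)
  have sq: "(q powr \<alpha>)\<^sup>2 = q powr (2 * \<alpha>)" for q :: real
    by (simp add: power2_eq_square flip: powr_add)
  obtain \<nu> where \<nu>: "jump_density (\<lambda>q. q powr \<alpha>) \<nu>"
    using jump_density_powr[of \<alpha>] \<alpha> by auto
  note aG = jump_density_add[OF jump_density_cmult[OF \<nu> a] G_jump]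
  show ?thesis
  proof (cases "\<alpha> = 1/2")
    case True
    then have "2 * \<alpha> = 1" by simp
    then have "(q powr \<alpha>)\<^sup>2 = q" if "0 < q" for q
      using that by (simp only: sq powr_one)
    then show ?thesis
      by (intro jump_density_imp_B2[OF aG b]) (simp add: f branching_fun_def G_def)
  next
    case False
    then obtain \<kappa> where \<kappa>: "jump_density (\<lambda>q. q powr (2 * \<alpha>)) \<kappa>"
      using jump_density_powr[of "2 * \<alpha>"] \<alpha> by auto
    show ?thesis
      by (rule jump_density_imp_B2[OF jump_density_add[OF jump_density_cmult[OF \<kappa> b] aG], of 0])
         (auto simp: f branching_fun_def G_def sq)
  qed
qed

section \<open>The characterisation of the exponents\<close>

text \<open>A special case of the subadditivity of Bernstein functions, from
  \<open>1 - e\<^sup>2 \<le> 2 (1 - e)\<close> for \<open>e = exp (- q x)\<close>.\<close>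

lemma B2_doubling:
  assumes "f \<in> B2" "0 < q"
  shows "f (2 * q) \<le> 2 * f q"
proof -
  obtain a b \<Lambda> where ab: "0 \<le> a" "0 \<le> b" and \<Lambda>: "bernstein_measure \<Lambda>"
    and f: "\<And>q. 0 < q \<Longrightarrow> f q = bernstein_fun a b \<Lambda> q"
    using assms(1) by (auto simp: B2_def)
  have sets: "sets \<Lambda> = sets (restrict_space borel {0<..})"
    using \<Lambda> by (simp add: bernstein_measure_def pos_reals_def)
  have sp: "space \<Lambda> = {0<..}"
    using sets_eq_imp_space_eq[OF sets] by (simp add: space_restrict_space)
  have meas: "h \<in> borel_measurable \<Lambda>" if "h \<in> borel_measurable borel" for h :: "real \<Rightarrow> real"
    using that by (auto simp: measurable_cong_sets[OF sets refl] intro!: measurable_restrict_space1)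
  have min: "integrable \<Lambda> (\<lambda>x. min x 1)"
    using \<Lambda> by (intro integrableI_nonneg meas AE_I2) (auto simp: bernstein_measure_def sp)
  have int: "integrable \<Lambda> (\<lambda>x. 1 - exp (- s * x))" if s: "0 < s" for s
  proof (rule Bochner_Integration.integrable_bound)
    show "integrable \<Lambda> (\<lambda>x. max s 1 * min x 1)" using min by (rule integrable_mult_right)
    show "AE x in \<Lambda>. norm (1 - exp (- s * x)) \<le> norm (max s 1 * min x 1)"
    proof (rule AE_I2)
      fix x assume "x \<in> space \<Lambda>"
      then have x: "0 < x" by (simp add: sp)
      have "1 - exp (- s * x) \<le> s * x" using exp_ge_add_one_self[of "- s * x"] by simp
      moreover have "s * x \<le> max s 1 * x" using x by (intro mult_right_mono) auto
      moreover have "1 - exp (- s * x) \<le> max s 1 * 1" by (simp add: le_max_iff_disj)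
      ultimately have "1 - exp (- s * x) \<le> max s 1 * min x 1" by (simp add: min_def)
      moreover have "0 \<le> 1 - exp (- s * x)" using s x by simp
      ultimately show "norm (1 - exp (- s * x)) \<le> norm (max s 1 * min x 1)"
        unfolding real_norm_def by linarith
    qed
  qed (intro meas, measurable)
  have "(\<integral>x. (1 - exp (- (2 * q) * x)) \<partial>\<Lambda>) \<le> (\<integral>x. 2 * (1 - exp (- q * x)) \<partial>\<Lambda>)"
  proof (rule integral_mono)
    fix x :: real
    have "exp (- (2 * q) * x) = (exp (- q * x))\<^sup>2"
      by (simp add: power2_eq_square flip: exp_add)
    moreover have "0 \<le> (1 - exp (- q * x))\<^sup>2" by simp
    ultimately show "1 - exp (- (2 * q) * x) \<le> 2 * (1 - exp (- q * x))"
      by (simp add: power2_eq_square algebra_simps)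
    show "integrable \<Lambda> (\<lambda>x. 1 - exp (- (2 * q) * x))" using int[of "2 * q"] assms(2) by simp
    show "integrable \<Lambda> (\<lambda>x. 2 * (1 - exp (- q * x)))"
      by (intro integrable_mult_right int assms)
  qed
  also have "\<dots> = 2 * (\<integral>x. (1 - exp (- q * x)) \<partial>\<Lambda>)"
    by (rule integral_mult_right_zero)
  finally show ?thesis
    using assms(2) ab by (simp add: f bernstein_fun_def)
qed

lemma square_in_B3: "(\<lambda>q. q\<^sup>2) \<in> B3"
proof -
  have "branching_measure (null_measure pos_reals)"
    by (simp add: branching_measure_def)
  then show ?thesis
    unfolding B3_def by (intro CollectI exI[of _ 0] exI[of _ 1] exI[of _ "null_measure pos_reals"])
      (simp add: branching_fun_def integral_null_measure)
qed

theorem theorem1: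
  fixes \<alpha> :: real
  assumes "\<alpha> \<in> {0<..<1}"
  shows "\<alpha> \<in> {0<..1/2} \<longleftrightarrow> (\<forall>\<Psi>\<in>B3. \<Psi> \<circ> e_pow \<alpha> \<in> B2)"
proof
  assume \<alpha>: "\<alpha> \<in> {0<..1/2}"
  show "\<forall>\<Psi>\<in>B3. \<Psi> \<circ> e_pow \<alpha> \<in> B2"
  proof
    fix \<Psi> assume "\<Psi> \<in> B3"
    then obtain a b \<mu> where *: "0 \<le> a" "0 \<le> b" "branching_measure \<mu>"
      and \<Psi>: "\<And>q. 0 < q \<Longrightarrow> \<Psi> q = branching_fun a b \<mu> q"
      by (auto simp: B3_def)
    show "\<Psi> \<circ> e_pow \<alpha> \<in> B2"
      by (rule branching_fun_powr_in_B2[OF _ _ *]) (use \<alpha> \<Psi> in \<open>auto simp: e_pow_def\<close>)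
  qed
next
  assume "\<forall>\<Psi>\<in>B3. \<Psi> \<circ> e_pow \<alpha> \<in> B2"
  then have "(\<lambda>q. q\<^sup>2) \<circ> e_pow \<alpha> \<in> B2" using square_in_B3 by blast
  from B2_doubling[OF this, of 1] have "(2 powr \<alpha>)\<^sup>2 \<le> (2::real)"
    by (simp add: e_pow_def)
  then have "(2::real) powr (2 * \<alpha>) \<le> 2 powr 1"
    by (simp add: power2_eq_square flip: powr_add)
  then have "2 * \<alpha> \<le> 1" by (subst (asm) powr_le_cancel_iff) auto
  then show "\<alpha> \<in> {0<..1/2}" using assms by auto
qed

thm_deps theorem1

end
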